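(* Let $b>1$ be real and suppose $K<\infty$. Let $d\in\mathcal{D}$ with $d\le d'$. (a) Let $\alpha,\beta\in(0,1)$ with $\log_b(\alpha\beta)\notin\mathbb{Q}$. Then $C_b[d]$ is $(\alpha,\beta)$-winning if $\beta>A_b(\alpha)$, where $$A_b(\alpha)=\frac{(2(Kb+2b)+1)\alpha-1}{\alpha\,[(4(Kb+2b)-1)-\alpha(2(Kb+2b)-1)]}.$$ (b) Suppose $\alpha<\dfrac{1}{2Kb^2+4b^2+1}$. Then $C_b[d]$ is $\alpha$-winning.
   Context: Digits: $\mathcal{D}=\{0,1,\dots,s_b\}$ with $s_b=b-1$ if $b\in\mathbb{N}$ and $s_b=\lfloor b\rfloor$ otherwise. For $x\in[0,1)$, the $b$-expansion $\mathbbm{d}(x)=d_1d_2\cdots$: $d_j$ is the unique integer in $\mathcal{D}$ with $b^j(x-\sum_{k=1}^{j}d_kb^{-k})\in[0,1)$. $d'$ is the minimal digit of $\lim_{\varepsilon\to0^+}\mathbbm{d}(1-\varepsilon)$ (digitwise limit). $K=K_b$: let $i\in\mathbb{N}\cup\{\infty\}$ be the maximal index of a nonzero digit of the $b$-expansion of $b-\lfloor b\rfloor$; $K$ is the maximal length of a block of zeros among the first $i$ digits of that expansion. $C_b[d]=\{x\in[0,1): d\text{ appears in }\mathbbm{d}(x)\}$. Schmidt game (played in the domain $[0,1)$ of the expansion with metric $|x-y|$): given $\alpha,\beta\in(0,1)$, Alice fixes a target set $S$; Bob picks an initial radius $\rho>0$ and center $x_0$, $B_0=\overline{B(x_0,\rho)}$.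 With $\rho_n=(\alpha\beta)^n\rho$, for $n\ge1$: Alice picks $y_n$ with $|x_{n-1}-y_n|+\alpha\rho_{n-1}\le\rho_{n-1}$, giving $A_n=\overline{B(y_n,\alpha\rho_{n-1})}$; then Bob picks $x_n$ with $|y_n-x_n|+\rho_n\le\alpha\rho_{n-1}$, giving $B_n=\overline{B(x_n,\rho_n)}$. The outcome $\omega$ is the unique point of $\bigcap_nA_n\cap\bigcap_nB_n$; Alice wins if $\omega\in S$. $S$ is $(\alpha,\beta,\rho)$-winning if Alice has a strategy winning regardless of Bob's play with initial radius $\rho$; $(\alpha,\beta)$-winning if $(\alpha,\beta,\rho)$-winning for all $\rho>0$; $\alpha$-winning if $(\alpha,\beta)$-winning for every $\beta\in(0,1)$. *)

theory Defs
  imports "HOL-Analysis.Analysis" "HOL-Library.Extended_Nat"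
begin

definition max_digit :: "real \<Rightarrow> nat" where
  "max_digit b = (if b \<in> \<nat> then nat \<lfloor>b\<rfloor> - 1 else nat \<lfloor>b\<rfloor>)"

definition digits :: "real \<Rightarrow> nat set" where
  "digits b = {0..max_digit b}"

text \<open>
  \<open>b_digit b x j\<close> is the digit $d_j$, with positions $j \ge 1$; the value at position 0 is
  meaningless and never used.
\<close>

function b_digit :: "real \<Rightarrow> real \<Rightarrow> nat \<Rightarrow> nat" where
  "b_digit b x j =
    (THE d. d \<in> digits b \<and>
       b ^ j * (x - ((\<Sum>k\<in>{1..<j}. real (b_digit b x k) / b ^ k) + real d / b ^ j)) \<in> {0..<1})"
  by pat_completeness auto
termination by (relation "inv_image less_than (\<lambda>(b, x, j). j)") auto

declare b_digit.simps [simp del]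

lemma b_digit_step:
  assumes b: "b > 1" and j: "j \<ge> 1"
    and r: "b ^ (j - 1) * (x - (\<Sum>k\<in>{1..<j}. real (b_digit b x k) / b ^ k)) \<in> {0..<1}"
  shows "\<exists>!d. d \<in> digits b \<and>
       b ^ j * (x - ((\<Sum>k\<in>{1..<j}. real (b_digit b x k) / b ^ k) + real d / b ^ j)) \<in> {0..<1}"
proof -
  define t where "t = b ^ (j - 1) * (x - (\<Sum>k\<in>{1..<j}. real (b_digit b x k) / b ^ k))"
  have t: "0 \<le> t" "t < 1" using r by (auto simp: t_def)
  have bj: "b ^ j = b * b ^ (j - 1)" using j by (cases j) auto
  have eq: "b ^ j * (x - ((\<Sum>k\<in>{1..<j}. real (b_digit b x k) / b ^ k) + real d / b ^ j)) =
      b * t - real d" for d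
  proof -
    have "b ^ j * (x - ((\<Sum>k\<in>{1..<j}. real (b_digit b x k) / b ^ k) + real d / b ^ j)) =
      b ^ j * (x - (\<Sum>k\<in>{1..<j}. real (b_digit b x k) / b ^ k)) - b ^ j * (real d / b ^ j)"
      by (simp add: right_diff_distrib distrib_left)
    also have "b ^ j * (real d / b ^ j) = real d" using b by simp
    finally show ?thesis by (simp add: t_def bj mult.assoc)
  qed
  have bt: "0 \<le> b * t" "b * t < b" using b t by auto
  have le: "nat \<lfloor>b * t\<rfloor> \<le> max_digit b"
  proof (cases "b \<in> \<nat>")
    case True
    then obtain m where m: "b = real m" by (auto elim: Nats_cases)
    have "\<lfloor>b * t\<rfloor> < int m" using bt m by (simp add: floor_less_iff)
    then show ?thesis using True m b by (simp add: max_digit_def)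
  next
    case False
    have "\<lfloor>b * t\<rfloor> \<le> \<lfloor>b\<rfloor>" using bt(2) by (intro floor_mono less_imp_le)
    then show ?thesis using False by (simp add: max_digit_def nat_mono)
  qed
  show ?thesis unfolding eq
  proof (rule ex1I[of _ "nat \<lfloor>b * t\<rfloor>"])
    show "nat \<lfloor>b * t\<rfloor> \<in> digits b \<and> b * t - real (nat \<lfloor>b * t\<rfloor>) \<in> {0..<1}"
      using le bt by (auto simp: digits_def) linarith
  next
    fix d assume "d \<in> digits b \<and> b * t - real d \<in> {0..<1}"
    then have "\<lfloor>b * t\<rfloor> = int d" by (auto simp: floor_eq_iff)
    then show "d = nat \<lfloor>b * t\<rfloor>" by simp
  qed
qed

lemma b_digit_remainder:
  assumes b: "b > 1" and x: "x \<in> {0..<1}"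
  shows "b ^ j * (x - (\<Sum>k\<in>{1..j}. real (b_digit b x k) / b ^ k)) \<in> {0..<1}"
proof (induction j)
  case 0
  then show ?case using x by simp
next
  case (Suc j)
  have eq: "{1..<Suc j} = {1..j}" by auto
  have "\<exists>!d. d \<in> digits b \<and>
       b ^ Suc j * (x - ((\<Sum>k\<in>{1..<Suc j}. real (b_digit b x k) / b ^ k) + real d / b ^ Suc j))
         \<in> {0..<1}"
  proof (rule b_digit_step)
    show "b ^ (Suc j - 1) * (x - (\<Sum>k\<in>{1..<Suc j}. real (b_digit b x k) / b ^ k)) \<in> {0..<1}"
      using Suc by (simp only: eq diff_Suc_1)
  qed (use b in simp_all)
  from theI'[OF this, folded b_digit.simps] show ?case by (simp only: eq) simp
qed

lemma b_digit_in_digits: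
  assumes b: "b > 1" and x: "x \<in> {0..<1}" and j: "j \<ge> 1"
  shows "b_digit b x j \<in> digits b"
proof -
  have eq: "{1..<j} = {1..j - 1}" using j by auto
  have "\<exists>!d. d \<in> digits b \<and>
       b ^ j * (x - ((\<Sum>k\<in>{1..<j}. real (b_digit b x k) / b ^ k) + real d / b ^ j)) \<in> {0..<1}"
    using b_digit_step[OF b j] b_digit_remainder[OF b x, of "j - 1"] unfolding eq by blast
  from theI'[OF this] show ?thesis by (subst b_digit.simps) blast
qed

text \<open>The digitwise limit of the expansions of $1 - \varepsilon$ (the digits carry the discrete
  topology of \<^typ>\<open>nat\<close>), and its minimal digit $d'$.\<close>

definition limit_digit :: "real \<Rightarrow> nat \<Rightarrow> nat" where
  "limit_digit b j = Lim (at_right 0) (\<lambda>\<epsilon>. b_digit b (1 - \<epsilon>) j)"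

lemma b_digit_Suc_eq_floor:
  assumes b: "b > 1" and x: "x \<in> {0..<1}"
  shows "int (b_digit b x (Suc j)) =
    \<lfloor>b ^ Suc j * (x - (\<Sum>k\<in>{1..j}. real (b_digit b x k) / b ^ k))\<rfloor>"
proof -
  define s where "s = (\<Sum>k\<in>{1..j}. real (b_digit b x k) / b ^ k)"
  define d where "d = b_digit b x (Suc j)"
  have "b ^ Suc j * (x - (s + real d / b ^ Suc j)) = b ^ Suc j * (x - s) - real d"
    using b by (simp add: right_diff_distrib distrib_left)
  moreover have "b ^ Suc j * (x - (s + real d / b ^ Suc j)) \<in> {0..<1}"
    using b_digit_remainder[OF b x, of "Suc j"] by (simp add: s_def d_def)
  ultimately have "\<lfloor>b ^ Suc j * (x - s)\<rfloor> = int d"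
    by (auto simp: floor_eq_iff)
  then show ?thesis by (simp add: s_def d_def)
qed

lemma limit_digits_exist:
  assumes b: "b > 1"
  shows "\<exists>L. \<forall>j\<in>{1..n}. eventually (\<lambda>\<epsilon>. b_digit b (1 - \<epsilon>) j = L j) (at_right 0)"
proof (induction n)
  case 0
  then show ?case by simp
next
  case (Suc n)
  then obtain L where L: "\<forall>j\<in>{1..n}. eventually (\<lambda>\<epsilon>. b_digit b (1 - \<epsilon>) j = L j) (at_right 0)"
    by blast
  define c where "c = b ^ Suc n * (1 - (\<Sum>k\<in>{1..n}. real (L k) / b ^ k))"
  have pos: "b ^ Suc n > 0" using b by simp
  define \<delta> where "\<delta> = (c - of_int (\<lceil>c\<rceil> - 1)) / b ^ Suc n"
  have \<delta>: "\<delta> > 0" using pos unfolding \<delta>_def by (intro divide_pos_pos) linarith+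
  have E: "eventually (\<lambda>\<epsilon>. \<forall>j\<in>{1..n}. b_digit b (1 - \<epsilon>) j = L j) (at_right 0)"
    using L by (simp add: eventually_ball_finite)
  have I: "eventually (\<lambda>\<epsilon>. \<epsilon> \<in> {0<..<min 1 \<delta>}) (at_right (0::real))"
    using \<delta> by (intro eventually_at_right_real) simp
  have "eventually (\<lambda>\<epsilon>. b_digit b (1 - \<epsilon>) (Suc n) = nat (\<lceil>c\<rceil> - 1)) (at_right 0)"
    using E I
  proof eventually_elim
    case (elim \<epsilon>)
    have "(\<Sum>k\<in>{1..n}. real (b_digit b (1 - \<epsilon>) k) / b ^ k) = (\<Sum>k\<in>{1..n}. real (L k) / b ^ k)"
      using elim(1) by (intro sum.cong) auto
    then have "int (b_digit b (1 - \<epsilon>) (Suc n)) = \<lfloor>c - b ^ Suc n * \<epsilon>\<rfloor>"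
      using b_digit_Suc_eq_floor[OF b, of "1 - \<epsilon>" n] elim(2)
      by (simp add: c_def algebra_simps)
    moreover have "b ^ Suc n * \<epsilon> > 0" using pos elim(2) by simp
    moreover have "b ^ Suc n * \<epsilon> < c - of_int (\<lceil>c\<rceil> - 1)"
      using pos elim(2) by (simp add: \<delta>_def pos_less_divide_eq mult.commute del: power_Suc)
    ultimately have "int (b_digit b (1 - \<epsilon>) (Suc n)) = \<lceil>c\<rceil> - 1"
      by (simp add: floor_eq_iff del: power_Suc) linarith
    then show ?case by simp
  qed
  with L have "\<forall>j\<in>{1..Suc n}. eventually (\<lambda>\<epsilon>. b_digit b (1 - \<epsilon>) j =
      (L(Suc n := nat (\<lceil>c\<rceil> - 1))) j) (at_right 0)"
    by (auto simp: le_Suc_eq)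
  then show ?case by blast
qed

lemma limit_digit_eventually:
  assumes "b > 1" and "j \<ge> 1"
  shows "eventually (\<lambda>\<epsilon>. b_digit b (1 - \<epsilon>) j = limit_digit b j) (at_right 0)"
proof -
  obtain l where l: "eventually (\<lambda>\<epsilon>. b_digit b (1 - \<epsilon>) j = l) (at_right 0)"
    using limit_digits_exist[OF assms(1), of j] assms(2) by (meson atLeastAtMost_iff order_refl)
  then have "((\<lambda>\<epsilon>. b_digit b (1 - \<epsilon>) j) \<longlongrightarrow> l) (at_right 0)"
    by (rule tendsto_eventually)
  then have "limit_digit b j = l"
    unfolding limit_digit_def by (intro tendsto_Lim) auto
  with l show ?thesis by simp
qed

definition min_limit_digit :: "real \<Rightarrow> nat" where
  "min_limit_digit b = (LEAST m. m \<in> limit_digit b ` {1..})"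

text \<open>
  \<open>last_nonzero b\<close> is the maximal index $i$ of a nonzero digit of the expansion of
  $b - \lfloor b \rfloor$: it is \<open>\<infinity>\<close> if there are infinitely many nonzero digits, and 0 if
  there are none (i.e. if $b$ is an integer), in which case $K_b = 0$.
\<close>

definition last_nonzero :: "real \<Rightarrow> enat" where
  "last_nonzero b = Sup {enat j | j. j \<ge> 1 \<and> b_digit b (b - of_int \<lfloor>b\<rfloor>) j \<noteq> 0}"

definition K_const :: "real \<Rightarrow> enat" where
  "K_const b = Sup {enat n | n. \<exists>m. enat (m + n) \<le> last_nonzero b \<and>
                      (\<forall>j\<in>{m + 1..m + n}. b_digit b (b - of_int \<lfloor>b\<rfloor>) j = 0)}"

definition C_set :: "real \<Rightarrow> nat \<Rightarrow> real set" where
  "C_set b d = {x \<in> {0..<1}. \<exists>j\<ge>1. b_digit b x j = d}"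

definition A_bound :: "real \<Rightarrow> real \<Rightarrow> real" where
  "A_bound b \<alpha> = (let M = real (the_enat (K_const b)) * b + 2 * b in
     ((2 * M + 1) * \<alpha> - 1) / (\<alpha> * ((4 * M - 1) - \<alpha> * (2 * M - 1))))"

text \<open>
  Schmidt's game played in a subset \<open>X\<close> of a metric space: all centers lie in \<open>X\<close>, and balls
  are closed balls of the subspace \<open>X\<close>.  \<open>x n\<close> ($n \ge 0$) and \<open>y n\<close> ($n \ge 1$) are the centers
  chosen by Bob and Alice.
\<close>

definition game_radius :: "real \<Rightarrow> real \<Rightarrow> real \<Rightarrow> nat \<Rightarrow> real" where
  "game_radius \<alpha> \<beta> \<rho> n = (\<alpha> * \<beta>) ^ n * \<rho>"

definition alice_legal ::
    "'a::metric_space set \<Rightarrow> real \<Rightarrow> real \<Rightarrow> real \<Rightarrow> (nat \<Rightarrow> 'a) \<Rightarrow> (nat \<Rightarrow> 'a) \<Rightarrow> nat \<Rightarrow> bool" where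
  "alice_legal X \<alpha> \<beta> \<rho> x y n \<longleftrightarrow> y n \<in> X \<and>
     dist (x (n - 1)) (y n) + \<alpha> * game_radius \<alpha> \<beta> \<rho> (n - 1) \<le> game_radius \<alpha> \<beta> \<rho> (n - 1)"

definition bob_legal ::
    "'a::metric_space set \<Rightarrow> real \<Rightarrow> real \<Rightarrow> real \<Rightarrow> (nat \<Rightarrow> 'a) \<Rightarrow> (nat \<Rightarrow> 'a) \<Rightarrow> nat \<Rightarrow> bool" where
  "bob_legal X \<alpha> \<beta> \<rho> x y n \<longleftrightarrow> x n \<in> X \<and>
     (n \<ge> 1 \<longrightarrow> dist (y n) (x n) + game_radius \<alpha> \<beta> \<rho> n \<le> \<alpha> * game_radius \<alpha> \<beta> \<rho> (n - 1))"

definition alice_ball ::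
    "'a::metric_space set \<Rightarrow> real \<Rightarrow> real \<Rightarrow> real \<Rightarrow> (nat \<Rightarrow> 'a) \<Rightarrow> nat \<Rightarrow> 'a set" where
  "alice_ball X \<alpha> \<beta> \<rho> y n = X \<inter> cball (y n) (\<alpha> * game_radius \<alpha> \<beta> \<rho> (n - 1))"

definition bob_ball ::
    "'a::metric_space set \<Rightarrow> real \<Rightarrow> real \<Rightarrow> real \<Rightarrow> (nat \<Rightarrow> 'a) \<Rightarrow> nat \<Rightarrow> 'a set" where
  "bob_ball X \<alpha> \<beta> \<rho> x n = X \<inter> cball (x n) (game_radius \<alpha> \<beta> \<rho> n)"

text \<open>
  A strategy \<open>\<sigma>\<close> for Alice maps Bob's previous centers $[x_0, \dots, x_{n-1}]$ to $y_n$.  It must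
  answer every legal partial play of Bob legally, so Alice cannot win by making an illegal move
  that leaves Bob without an answer.  If \<open>X\<close> is not complete the balls may have empty
  intersection; Alice does not win such a play.
\<close>

definition schmidt_winning_radius ::
    "'a::metric_space set \<Rightarrow> real \<Rightarrow> real \<Rightarrow> real \<Rightarrow> 'a set \<Rightarrow> bool" where
  "schmidt_winning_radius X \<alpha> \<beta> \<rho> S \<longleftrightarrow>
     (\<exists>\<sigma> :: 'a list \<Rightarrow> 'a. \<forall>x :: nat \<Rightarrow> 'a.
        let y = (\<lambda>n. \<sigma> (map x [0..<n])) in
        (\<forall>n\<ge>1. (\<forall>m<n. bob_legal X \<alpha> \<beta> \<rho> x y m) \<longrightarrow> alice_legal X \<alpha> \<beta> \<rho> x y n) \<and>
        ((\<forall>n. bob_legal X \<alpha> \<beta> \<rho> x y n) \<longrightarrow>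
           (\<exists>\<omega>\<in>S. (\<Inter>n\<in>{1..}. alice_ball X \<alpha> \<beta> \<rho> y n) \<inter> (\<Inter>n. bob_ball X \<alpha> \<beta> \<rho> x n) = {\<omega>})))"

definition schmidt_winning2 ::
    "'a::metric_space set \<Rightarrow> real \<Rightarrow> real \<Rightarrow> 'a set \<Rightarrow> bool" where
  "schmidt_winning2 X \<alpha> \<beta> S \<longleftrightarrow> (\<forall>\<rho>>0. schmidt_winning_radius X \<alpha> \<beta> \<rho> S)"

definition schmidt_winning ::
    "'a::metric_space set \<Rightarrow> real \<Rightarrow> 'a set \<Rightarrow> bool" where
  "schmidt_winning X \<alpha> S \<longleftrightarrow> (\<forall>\<beta>\<in>{0<..<1}. schmidt_winning2 X \<alpha> \<beta> S)"

end

theory Submission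
  imports Defs
begin

text \<open>
  The idea: for every \<open>j\<close>, each point of \<open>[0, 1)\<close> is within \<open>2 / b ^ j\<close> of the center of an interval
  of length \<open>1 / b ^ (j + 1)\<close> on which the digit \<open>d\<close> appears. If Bob's radius is \<open>R\<close> and Alice always
  moves as far as possible towards such a center \<open>c\<close>, then a distance to \<open>c\<close> shrinks by at least
  \<open>(1 - 2\<alpha> + \<alpha>\<beta>) R\<close> in a round, and once Alice sits on \<open>c\<close> Bob can gain only
  \<open>\<alpha> (1 - 2\<beta> + \<alpha>\<beta>) R\<close> per round. Summing the geometric series, the outcome stays in the interval
  as soon as \<open>R b ^ j\<close> lies in a certain window. The bound on \<open>\<beta>\<close> says that the window is
  nonempty, and irrationality of \<open>log b (\<alpha>\<beta>)\<close> lets Alice wait until the window is hit; the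
  bound on \<open>\<alpha>\<close> in the second part says that the window spans a factor larger than \<open>b\<close>, so that it is
  hit for free.
\<close>

section \<open>The expansion map\<close>

text \<open>This is Renyi's beta-transformation. Its \<open>j\<close>-th iterate is the remainder
  after \<open>j\<close> digits, rescaled by \<open>b ^ j\<close>, so questions about digits become
  questions about orbits.\<close>

definition beta_map :: "real \<Rightarrow> real \<Rightarrow> real" where
  "beta_map b t = frac (b * t)"

lemma beta_map_funpow_Suc: "(beta_map b ^^ Suc j) x = frac (b * (beta_map b ^^ j) x)"
  unfolding funpow.simps o_apply by (simp only: beta_map_def)

lemma beta_map_funpow_range:
  assumes "x \<in> {0..<1}"
  shows "(beta_map b ^^ j) x \<in> {0..<1}"
  using assms by (cases j) (auto simp: frac_lt_1 beta_map_funpow_Suc simp del: funpow.simps(2))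

lemma beta_map_funpow_eq_remainder:
  assumes b: "b > 1" and x: "x \<in> {0..<1}"
  shows "(beta_map b ^^ j) x = b ^ j * (x - (\<Sum>k\<in>{1..j}. real (b_digit b x k) / b ^ k))"
proof (induction j)
  case 0
  then show ?case by simp
next
  case (Suc j)
  define r where "r = b ^ Suc j * (x - (\<Sum>k\<in>{1..j}. real (b_digit b x k) / b ^ k))"
  have "b ^ Suc j * (x - (\<Sum>k\<in>{1..Suc j}. real (b_digit b x k) / b ^ k)) =
      r - real (b_digit b x (Suc j))"
    using b by (simp add: r_def right_diff_distrib distrib_left)
  also have "real (b_digit b x (Suc j)) = of_int \<lfloor>r\<rfloor>"
    using b_digit_Suc_eq_floor[OF b x, of j] unfolding r_def by (metis of_int_of_nat_eq)
  also have "r = b * (beta_map b ^^ j) x"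
    by (simp add: Suc r_def)
  finally show ?case
    by (simp only: beta_map_funpow_Suc frac_def)
qed

lemma b_digit_Suc_eq:
  assumes b: "b > 1" and x: "x \<in> {0..<1}"
  shows "int (b_digit b x (Suc j)) = \<lfloor>b * (beta_map b ^^ j) x\<rfloor>"
  unfolding b_digit_Suc_eq_floor[OF b x] beta_map_funpow_eq_remainder[OF b x]
  by (simp add: mult.assoc)

lemma b_digit_Suc_Suc:
  assumes b: "b > 1" and x: "x \<in> {0..<1}"
  shows "b_digit b x (Suc (Suc j)) = b_digit b (beta_map b x) (Suc j)"
proof -
  have "beta_map b x \<in> {0..<1}"
    using beta_map_funpow_range[OF x, of 1 b] by simp
  from b_digit_Suc_eq[OF b this, of j] b_digit_Suc_eq[OF b x, of "Suc j"] show ?thesis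
    by (simp add: funpow_swap1)
qed

lemma beta_map_decomp:
  assumes b: "b > 1" and x: "x \<in> {0..<1}"
  shows "b * x = real (b_digit b x 1) + beta_map b x"
  using b_digit_Suc_eq[OF b x, of 0] by (simp add: beta_map_def frac_def)

lemma C_setI:
  assumes b: "b > 1" and x: "x \<in> {0..<1}"
    and "real d / b \<le> (beta_map b ^^ j) x" "(beta_map b ^^ j) x < (real d + 1) / b"
  shows "x \<in> C_set b d"
proof -
  have "\<lfloor>b * (beta_map b ^^ j) x\<rfloor> = int d"
    using assms by (intro floor_unique) (auto simp: field_simps)
  then have "b_digit b x (Suc j) = d"
    using b_digit_Suc_eq[OF b x, of j] by simp
  then show ?thesis
    using x by (auto simp: C_set_def intro!: exI[of _ "Suc j"])
qed

text \<open>As long as the shifted orbit stays in \<open>[0, 1)\<close>, no integer part changes, so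
  each step merely multiplies the shift by \<open>b\<close>.\<close>

lemma beta_map_funpow_translate:
  assumes "\<And>i. i \<le> j \<Longrightarrow> (beta_map b ^^ i) z + b ^ i * \<delta> \<in> {0..<1}"
  shows "(beta_map b ^^ j) (z + \<delta>) = (beta_map b ^^ j) z + b ^ j * \<delta>"
  using assms
proof (induction j)
  case 0
  then show ?case by simp
next
  case (Suc j)
  define w where "w = (beta_map b ^^ j) z"
  have "(beta_map b ^^ Suc j) (z + \<delta>) = frac (b * w + b ^ Suc j * \<delta>)"
    using Suc by (simp add: beta_map_funpow_Suc w_def algebra_simps del: funpow.simps(2))
  also have "\<dots> = frac (b * w) + b ^ Suc j * \<delta>"
    using Suc.prems[of "Suc j"] unfolding frac_unique_iff beta_map_funpow_Suc w_def[symmetric]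
    by (auto simp: frac_def)
  finally show ?case
    by (simp only: w_def beta_map_funpow_Suc)
qed

lemma beta_map_funpow_le:
  assumes "b > 0" "x \<ge> 0"
  shows "(beta_map b ^^ j) x \<le> b ^ j * x"
proof (induction j)
  case 0
  then show ?case by simp
next
  case (Suc j)
  have "0 \<le> (beta_map b ^^ j) x"
    using assms by (cases j) (auto simp: beta_map_funpow_Suc simp del: funpow.simps(2))
  then have "0 \<le> b * (beta_map b ^^ j) x"
    using assms by simp
  then have "(beta_map b ^^ Suc j) x \<le> b * (beta_map b ^^ j) x"
    by (simp only: beta_map_funpow_Suc frac_def) simp
  also have "\<dots> \<le> b * (b ^ j * x)"
    using assms Suc by (intro mult_left_mono) auto
  finally show ?case
    by (simp add: mult.assoc)
qed

text \<open>Moving left inside a cylinder (the points sharing the first \<open>j\<close> digits) is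
  always possible: by \<open>beta_map_funpow_le\<close>, a remainder of at least \<open>s\<close> at
  level \<open>j\<close> forces one of at least \<open>s / b ^ (j - k)\<close> at each earlier level
  \<open>k\<close>.\<close>

lemma beta_map_funpow_between:
  assumes b: "b > 1" and x: "x \<in> {0..<1}"
    and s: "0 \<le> s" "s \<le> (beta_map b ^^ j) x" and i: "i \<le> j"
  shows "(beta_map b ^^ i) (x - s / b ^ j) = (beta_map b ^^ i) x - s / b ^ (j - i)"
proof -
  have *: "b ^ k * (- (s / b ^ j)) = - (s / b ^ (j - k))" if "k \<le> j" for k
    using b that by (simp add: power_diff)
  have "(beta_map b ^^ k) x + b ^ k * (- (s / b ^ j)) \<in> {0..<1}" if k: "k \<le> j" for k
  proof -
    have r: "(beta_map b ^^ k) x \<in> {0..<1}"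
      by (rule beta_map_funpow_range[OF x])
    have "s \<le> (beta_map b ^^ (j - k)) ((beta_map b ^^ k) x)"
      using s k funpow_add[of "j - k" k "beta_map b"] by simp
    also have "\<dots> \<le> b ^ (j - k) * (beta_map b ^^ k) x"
      using b r by (intro beta_map_funpow_le) auto
    finally have "s / b ^ (j - k) \<le> (beta_map b ^^ k) x"
      using b by (simp add: field_simps)
    moreover have "s / b ^ (j - k) \<ge> 0"
      using b s by simp
    ultimately show ?thesis
      using r unfolding *[OF k] by auto
  qed
  then have "(beta_map b ^^ i) (x + - (s / b ^ j)) = (beta_map b ^^ i) x + b ^ i * (- (s / b ^ j))"
    using i by (intro beta_map_funpow_translate) auto
  then show ?thesis
    using *[OF i] by simp
qed

section \<open>Digits of points close to 1\<close>

text \<open>Finitely many digits of points just below 1 agree simultaneously with the limit digits,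
  all of which are at least \<open>d\<close>.\<close>

lemma near_one_digits:
  assumes b: "b > 1" and d: "d \<le> min_limit_digit b" and u: "u < 1"
  shows "\<exists>y\<in>{0..<1}. u \<le> y \<and> (\<forall>j\<in>{1..n}. d \<le> b_digit b y j)"
proof -
  have d_le: "d \<le> limit_digit b j" if "j \<ge> 1" for j
    using d Least_le[of "\<lambda>m. m \<in> limit_digit b ` {1..}" "limit_digit b j"] that
    by (force simp: min_limit_digit_def)
  have E: "eventually (\<lambda>\<epsilon>. \<forall>j\<in>{1..n}. b_digit b (1 - \<epsilon>) j = limit_digit b j) (at_right 0)"
    using limit_digit_eventually[OF b] by (intro eventually_ball_finite) auto
  have I: "eventually (\<lambda>\<epsilon>. \<epsilon> \<in> {0<..<min 1 (1 - u)}) (at_right (0::real))"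
    using u by (intro eventually_at_right_real) simp
  have "eventually (\<lambda>\<epsilon>. (\<forall>j\<in>{1..n}. b_digit b (1 - \<epsilon>) j = limit_digit b j) \<and>
      \<epsilon> \<in> {0<..<min 1 (1 - u)}) (at_right (0::real))"
    using E I by (rule eventually_conj)
  then obtain \<epsilon> where \<epsilon>: "\<forall>j\<in>{1..n}. b_digit b (1 - \<epsilon>) j = limit_digit b j"
      "\<epsilon> \<in> {0<..<min 1 (1 - u)}"
    using eventually_happens'[OF trivial_limit_at_right_real] by blast
  then show ?thesis
    using d_le by (intro bexI[of _ "1 - \<epsilon>"]) auto
qed

text \<open>Such a \<open>y\<close> is at least the finite geometric sum of
  \<open>d / b ^ k\<close>; the induction peels off the first digit.\<close>

lemma digits_ge_imp_ge:
  assumes b: "b > 1" and y: "y \<in> {0..<1}" and dig: "\<And>j. j \<in> {1..n} \<Longrightarrow> d \<le> b_digit b y j"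
  shows "real d * (1 - 1 / b ^ n) \<le> (b - 1) * y"
  using y dig
proof (induction n arbitrary: y)
  case 0
  then show ?case using b by simp
next
  case (Suc n)
  have T: "beta_map b y \<in> {0..<1}"
    using beta_map_funpow_range[OF Suc.prems(1), of 1 b] by simp
  have "real d * (1 - 1 / b ^ n) \<le> (b - 1) * beta_map b y"
  proof (rule Suc.IH[OF T])
    fix j assume "j \<in> {1..n}"
    then show "d \<le> b_digit b (beta_map b y) j"
      using Suc.prems(2)[of "Suc j"] b_digit_Suc_Suc[OF b Suc.prems(1), of "j - 1"] by simp
  qed
  moreover have "(b - 1) * real d \<le> (b - 1) * real (b_digit b y 1)"
    using Suc.prems(2)[of 1] b by (intro mult_left_mono) auto
  moreover have "b * ((b - 1) * y) = (b - 1) * real (b_digit b y 1) + (b - 1) * beta_map b y"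
    using beta_map_decomp[OF b Suc.prems(1)] by (metis distrib_left mult.left_commute)
  moreover have "b * (real d * (1 - 1 / b ^ Suc n)) = (b - 1) * real d + real d * (1 - 1 / b ^ n)"
    using b by (simp add: field_simps)
  ultimately have "b * (real d * (1 - 1 / b ^ Suc n)) \<le> b * ((b - 1) * y)"
    by linarith
  then show ?case
    using b by simp
qed

text \<open>Points below 1 with arbitrarily many digits at least \<open>d\<close> exist, so the full
  geometric sum \<open>d / (b - 1)\<close> is at most 1. Thus the interval from \<open>d / b\<close>
  to \<open>(d + 1) / b\<close> fits below 1.\<close>

lemma le_min_limit_digit_imp_le:
  assumes b: "b > 1" and d: "d \<le> min_limit_digit b"
  shows "real d + 1 \<le> b"
proof -
  have "real d * (1 - (1 / b) ^ n) \<le> b - 1" for n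
  proof -
    obtain y where y: "y \<in> {0..<1}" "\<forall>j\<in>{1..n}. d \<le> b_digit b y j"
      using near_one_digits[OF b d, of 0 n] by auto
    have "real d * (1 - 1 / b ^ n) \<le> (b - 1) * y"
      using y by (intro digits_ge_imp_ge[OF b]) auto
    also have "\<dots> \<le> (b - 1) * 1"
      using y b by (intro mult_left_mono) auto
    finally show ?thesis by (simp add: power_one_over)
  qed
  moreover have "(\<lambda>n. real d * (1 - (1 / b) ^ n)) \<longlonglongrightarrow> real d * (1 - 0)"
    using b by (intro tendsto_intros LIMSEQ_realpow_zero) auto
  ultimately have "real d * (1 - 0) \<le> b - 1"
    by (intro LIMSEQ_le_const2) auto
  then show ?thesis by simp
qed

text \<open>Compare \<open>u\<close> with a point \<open>y\<close> near 1 all of whose leading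
  digits are at least \<open>d\<close>. If the first \<open>k\<close> digits agree, digit
  \<open>k + 1\<close> of \<open>y\<close> alone provides the gap. Otherwise, at the first
  disagreement, the digit of \<open>y\<close> is larger by at least 1, and it suffices that the
  shifted tail of \<open>u\<close> has a gap below 1.\<close>

lemma terminating_expansion_gap:
  assumes b: "b > 1" and d: "d \<le> min_limit_digit b"
    and u: "u \<in> {0..<1}" and "(beta_map b ^^ k) u = 0"
  shows "real d / b ^ Suc k \<le> 1 - u"
proof -
  \<comment> \<open>Letting \<open>y\<close> tend to 1, the gap below points \<open>y\<close> with large digits gives the gap below 1; this
    in turn feeds the inductive step for \<open>y\<close> when the leading digits of \<open>u\<close> and \<open>y\<close> differ.\<close>
  have gap1: "real d / b ^ Suc k \<le> 1 - u"
    if gap: "\<And>u y. u \<in> {0..<1} \<Longrightarrow> y \<in> {0..<1} \<Longrightarrow> u \<le> y \<Longrightarrow> (beta_map b ^^ k) u = 0 \<Longrightarrow>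
        (\<forall>j\<in>{1..Suc k}. d \<le> b_digit b y j) \<Longrightarrow> real d / b ^ Suc k \<le> y - u"
      and u: "u \<in> {0..<1}" "(beta_map b ^^ k) u = 0" for u k
  proof -
    obtain y where y: "y \<in> {0..<1}" "u \<le> y" "\<forall>j\<in>{1..Suc k}. d \<le> b_digit b y j"
      using near_one_digits[OF b d, of u "Suc k"] u by auto
    from gap[OF u(1) y(1,2) u(2) y(3)] y(1) show ?thesis by simp
  qed
  have gap: "real d / b ^ Suc k \<le> y - u"
    if "u \<in> {0..<1}" "y \<in> {0..<1}" "u \<le> y" "(beta_map b ^^ k) u = 0"
      "\<forall>j\<in>{1..Suc k}. d \<le> b_digit b y j" for u y k
    using that
  proof (induction k arbitrary: u y)
    case 0
    have "0 \<le> beta_map b y"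
      by (simp add: beta_map_def)
    with 0 beta_map_decomp[OF b 0(2)] have "real d \<le> b * y"
      by simp
    with 0 b show ?case
      by (simp add: field_simps)
  next
    case (Suc k)
    define u' y' where "u' = beta_map b u" and "y' = beta_map b y"
    have u': "u' \<in> {0..<1}" and y': "y' \<in> {0..<1}"
      using beta_map_funpow_range[OF Suc.prems(1), of 1 b]
        beta_map_funpow_range[OF Suc.prems(2), of 1 b] by (simp_all add: u'_def y'_def)
    have zero: "(beta_map b ^^ k) u' = 0"
      using Suc.prems(4) by (simp add: u'_def funpow_swap1)
    have dec: "b * u = real (b_digit b u 1) + u'" "b * y = real (b_digit b y 1) + y'"
      using beta_map_decomp[OF b] Suc.prems(1,2) by (simp_all add: u'_def y'_def)
    have le: "b_digit b u 1 \<le> b_digit b y 1"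
    proof -
      have "\<lfloor>b * u\<rfloor> \<le> \<lfloor>b * y\<rfloor>"
        using Suc.prems(3) b by (intro floor_mono) simp
      then show ?thesis
        using b_digit_Suc_eq[OF b Suc.prems(1), of 0] b_digit_Suc_eq[OF b Suc.prems(2), of 0] by simp
    qed
    have "real d / b ^ Suc k \<le> b * y - b * u"
    proof (cases "b_digit b u 1 = b_digit b y 1")
      case True
      have "u' \<le> y'"
        using dec True Suc.prems(3) b by (metis add_le_cancel_left mult_left_mono less_eq_real_def
            order_trans zero_le_one)
      moreover have "\<forall>j\<in>{1..Suc k}. d \<le> b_digit b y' j"
      proof
        fix j assume "j \<in> {1..Suc k}"
        then show "d \<le> b_digit b y' j"
          using Suc.prems(5) b_digit_Suc_Suc[OF b Suc.prems(2), of "j - 1"]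
          by (auto simp: y'_def dest: bspec[of _ _ "Suc j"])
      qed
      ultimately have "real d / b ^ Suc k \<le> y' - u'"
        by (intro Suc.IH u' y' zero)
      then show ?thesis
        using dec True by simp
    next
      case False
      then have "real (b_digit b u 1) + 1 \<le> real (b_digit b y 1)"
        using le by linarith
      moreover have "real d / b ^ Suc k \<le> 1 - u'"
        using Suc.IH u' zero by (rule gap1)
      ultimately show ?thesis
        using dec y' by auto
    qed
    then have "real d / b ^ Suc k / b \<le> y - u"
      using b by (subst pos_divide_le_eq) (auto simp: algebra_simps)
    then show ?case
      by (simp add: field_simps)
  qed
  show ?thesis
    using gap u assms(4) by (rule gap1)
qed

section \<open>Intervals of points having the digit\<close>

text \<open>\<open>cyl\<close> says that the cylinder of level \<open>j\<close> starting at
  \<open>a\<close> reaches at least to the end of digit \<open>d\<close>; on it the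
  \<open>j\<close>-th iterate is affine, so the digit interval can be pulled back.\<close>

lemma C_set_digit_interval:
  assumes b: "b > 1"
    and cyl: "\<And>s. 0 \<le> s \<Longrightarrow> s < (real d + 1) / b \<Longrightarrow>
      a + s / b ^ j \<in> {0..<1} \<and> (beta_map b ^^ j) (a + s / b ^ j) = s"
  shows "{a + real d / b ^ Suc j<..<a + (real d + 1) / b ^ Suc j} \<subseteq> C_set b d"
proof
  fix w assume w: "w \<in> {a + real d / b ^ Suc j<..<a + (real d + 1) / b ^ Suc j}"
  define s where "s = (w - a) * b ^ j"
  have w_eq: "w = a + s / b ^ j"
    using b by (simp add: s_def)
  have s: "real d / b < s" "s < (real d + 1) / b"
    using w b by (auto simp: s_def field_simps)
  moreover have "0 \<le> real d / b"
    using b by simp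
  ultimately have "w \<in> {0..<1} \<and> (beta_map b ^^ j) w = s"
    unfolding w_eq by (intro cyl) auto
  with s show "w \<in> C_set b d"
    by (intro C_setI[OF b, where j = j]) auto
qed

text \<open>Cylinders may be too short to hold a full digit-0 interval. If all remainders in the
  window just left of \<open>x\<close> are below \<open>1 / b\<close>, the window itself serves.
  Otherwise some \<open>y\<close> in it has a larger remainder, and the cylinder of \<open>y\<close>
  starts with a full digit-0 interval. Points \<open>x\<close> too close to 0 for this use the
  interval starting at 0.\<close>

lemma C_set_zero_interval:
  assumes b: "b > 1" and x: "x \<in> {0..<1}"
  shows "\<exists>a. {a<..<a + 1 / b ^ Suc j} \<subseteq> C_set b 0 \<and> x - 2 / b ^ j \<le> a \<and> a + 1 / b ^ Suc j \<le> x + 2 / b ^ j"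
proof -
  have le: "1 / b ^ Suc j \<le> 1 / b ^ j" "0 < 1 / b ^ Suc j"
    using b by (auto simp: field_simps)
  consider "x < 1 / b ^ j"
    | "1 / b ^ j \<le> x" "\<forall>z\<in>{x - 1 / b ^ Suc j..x}. (beta_map b ^^ j) z < 1 / b"
    | y where "1 / b ^ j \<le> x" "y \<in> {x - 1 / b ^ Suc j..x}" "1 / b \<le> (beta_map b ^^ j) y"
    by force
  then show ?thesis
  proof cases
    case 1
    have "{0<..<1 / b ^ Suc j} \<subseteq> C_set b 0"
    proof
      fix w assume w: "w \<in> {0<..<1 / b ^ Suc j}"
      have "1 / b ^ Suc j \<le> 1"
        using b one_le_power[of b "Suc j"] by (simp del: power_Suc)
      with w have w01: "w \<in> {0..<1}" by auto
      have "(beta_map b ^^ j) w \<le> b ^ j * w"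
        using b w by (intro beta_map_funpow_le) auto
      also have "\<dots> < 1 / b"
        using w b by (simp add: field_simps)
      finally show "w \<in> C_set b 0"
        using beta_map_funpow_range[OF w01] by (intro C_setI[OF b w01, where j = j]) auto
    qed
    then show ?thesis
      using 1 le x by (intro exI[of _ 0]) auto
  next
    case 2
    have "{x - 1 / b ^ Suc j<..<x} \<subseteq> C_set b 0"
    proof
      fix w assume w: "w \<in> {x - 1 / b ^ Suc j<..<x}"
      then have w01: "w \<in> {0..<1}"
        using 2 le x by auto
      then show "w \<in> C_set b 0"
        using beta_map_funpow_range[OF w01] 2 w by (intro C_setI[OF b w01, where j = j]) auto
    qed
    moreover have "x - 2 / b ^ j \<le> x - 1 / b ^ Suc j" "x \<le> x + 2 / b ^ j"
      using le by argo+
    ultimately show ?thesis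
      by (intro exI[of _ "x - 1 / b ^ Suc j"]) simp
  next
    case 3
    define t where "t = (beta_map b ^^ j) y"
    have y01: "y \<in> {0..<1}"
      using 3 le x by auto
    have t: "t \<in> {0..<1}" "1 / b \<le> t"
      using beta_map_funpow_range[OF y01] 3 by (simp_all add: t_def)
    have ty: "t / b ^ j \<le> y"
      using beta_map_funpow_le[of b y j] y01 b by (simp add: t_def field_simps)
    have "{y - t / b ^ j + real 0 / b ^ Suc j<..<y - t / b ^ j + (real 0 + 1) / b ^ Suc j} \<subseteq> C_set b 0"
    proof (rule C_set_digit_interval[OF b])
      fix s :: real assume s: "0 \<le> s" "s < (real 0 + 1) / b"
      have eq: "y - t / b ^ j + s / b ^ j = y - (t - s) / b ^ j"
        by (simp add: diff_divide_distrib)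
      have "0 \<le> s / b ^ j" "0 \<le> (t - s) / b ^ j"
        using s t b by auto
      then have "y - t / b ^ j + s / b ^ j \<in> {0..<1}"
        using ty y01 eq by auto
      moreover have "(beta_map b ^^ j) (y - (t - s) / b ^ j) = t - (t - s) / b ^ (j - j)"
        unfolding t_def using s t by (intro beta_map_funpow_between[OF b y01]) (auto simp: t_def)
      ultimately show "y - t / b ^ j + s / b ^ j \<in> {0..<1} \<and>
          (beta_map b ^^ j) (y - t / b ^ j + s / b ^ j) = s"
        by (simp add: eq)
    qed
    moreover have "t / b ^ j \<le> 1 / b ^ j" "0 \<le> t / b ^ j"
      using t b by (auto simp: divide_right_mono)
    ultimately show ?thesis
      using 3 le by (intro exI[of _ "y - t / b ^ j"]) auto
  qed
qed

text \<open>Either the cylinder of \<open>x\<close> is long enough for digit \<open>d\<close>, or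
  its left neighbour is. Each has length at most \<open>1 / b ^ j\<close>, whence the constant
  2.\<close>

lemma C_set_pos_interval:
  assumes b: "b > 1" and d: "d \<le> min_limit_digit b" "d \<noteq> 0" and x: "x \<in> {0..<1}"
  shows "\<exists>a. {a + real d / b ^ Suc j<..<a + (real d + 1) / b ^ Suc j} \<subseteq> C_set b d \<and>
    x - 2 / b ^ j \<le> a \<and> a \<le> x"
proof -
  define t where "t = (beta_map b ^^ j) x"
  define a where "a = x - t / b ^ j"
  have t: "t \<in> {0..<1}"
    unfolding t_def by (rule beta_map_funpow_range[OF x])
  have tj: "t / b ^ j \<le> 1 / b ^ j" "0 \<le> t / b ^ j"
    using t b by (auto simp: divide_right_mono)
  have "t / b ^ j \<le> x"
    using beta_map_funpow_le[of b x j] x b by (simp add: t_def field_simps)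
  then have a: "a \<in> {0..<1}"
    using x tj by (auto simp: a_def)
  note rng = beta_map_funpow_range[OF a, of _ b]
  have a_zero: "(beta_map b ^^ j) a = 0"
    using beta_map_funpow_between[OF b x, of t j j] t by (simp add: a_def t_def)
  have d_le: "real d + 1 \<le> b"
    by (rule le_min_limit_digit_imp_le[OF b d(1)])
  \<comment> \<open>A positive \<open>d\<close> forces \<open>b\<close> to be at least 2. So a gap
    of \<open>d\<close> units at one level holds at least \<open>d + 1\<close> units of the next
    finer level.\<close>
  have "real d + 1 \<le> 2 * real d"
    using d(2) by simp
  also have "\<dots> \<le> b * real d"
    using d_le d(2) by (intro mult_right_mono) auto
  finally have bd: "real d + 1 \<le> b * real d" .
  show ?thesis
  \<comment> \<open>This is what \<open>beta_map_funpow_translate\<close> needs to move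
    \<open>a\<close> right by any amount below \<open>(d + 1) / b ^ Suc j\<close>.\<close>
  proof (cases "\<forall>i\<le>j. (beta_map b ^^ i) a + (real d + 1) / b ^ Suc (j - i) \<le> 1")
    case True
    have "{a + real d / b ^ Suc j<..<a + (real d + 1) / b ^ Suc j} \<subseteq> C_set b d"
    proof (rule C_set_digit_interval[OF b])
      fix s :: real assume s: "0 \<le> s" "s < (real d + 1) / b"
      have *: "(beta_map b ^^ i) a + b ^ i * (s / b ^ j) \<in> {0..<1}" if i: "i \<le> j" for i
      proof -
        have "b ^ i * (s / b ^ j) = s / b ^ (j - i)"
          using b i by (simp add: power_diff)
        moreover have "s / b ^ (j - i) < (real d + 1) / b / b ^ (j - i)"
          using s b by (intro divide_strict_right_mono) auto
        moreover have "0 \<le> s / b ^ (j - i)"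
          using s b by simp
        ultimately show ?thesis
          using True i rng[of i] by (auto simp: mult.commute intro: less_le_trans)
      qed
      show "a + s / b ^ j \<in> {0..<1} \<and> (beta_map b ^^ j) (a + s / b ^ j) = s"
        using *[of 0] beta_map_funpow_translate[OF *] a_zero b by auto
    qed
    then show ?thesis
      using tj by (intro exI[of _ a]) (auto simp: a_def)
  next
    \<comment> \<open>The cylinder of \<open>x\<close> is too short, so its last digit is positive and its left neighbour is
      a full cylinder.\<close>
    case False
    have "j > 0"
    proof (rule ccontr)
      assume "\<not> j > 0"
      then have "j = 0" "a = 0"
        using a_zero by auto
      then show False
        using False d_le b by simp
    qed
    then obtain k where k: "j = Suc k"
      by (cases j) auto
    \<comment> \<open>Had the expansion of \<open>a\<close> ended one level earlier, the gap below 1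
      would leave enough room at every level, which is the first case.\<close>
    have nz: "(beta_map b ^^ k) a \<noteq> 0"
    proof
      assume zero: "(beta_map b ^^ k) a = 0"
      have "(beta_map b ^^ i) a + (real d + 1) / b ^ Suc (j - i) \<le> 1" if i: "i \<le> j" for i
      proof (cases "i = j")
        case True
        then show ?thesis
          using a_zero d_le b by simp
      next
        case False
        with i k have ik: "i \<le> k" by simp
        have "(beta_map b ^^ (k - i)) ((beta_map b ^^ i) a) = 0"
          using zero ik funpow_add[of "k - i" i "beta_map b"] by simp
        then have "real d / b ^ Suc (k - i) \<le> 1 - (beta_map b ^^ i) a"
          by (intro terminating_expansion_gap[OF b d(1)] rng)
        moreover have "(real d + 1) / b ^ Suc (j - i) \<le> (b * real d) / b ^ Suc (j - i)"
          using bd b by (intro divide_right_mono) auto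
        moreover have "(b * real d) / b ^ Suc (j - i) = real d / b ^ Suc (k - i)"
          using b k ik by (simp add: Suc_diff_le)
        ultimately show ?thesis by linarith
      qed
      with False show False by blast
    qed
    have "b * (beta_map b ^^ k) a = of_int \<lfloor>b * (beta_map b ^^ k) a\<rfloor>"
      using a_zero unfolding k beta_map_funpow_Suc frac_def by simp
    then obtain m :: int where m: "b * (beta_map b ^^ k) a = of_int m"
      by blast
    have "0 < b * (beta_map b ^^ k) a"
      using nz rng[of k] b by auto
    then have m1: "1 \<le> m"
      using m by simp
    have "{a - 1 / b ^ j + real d / b ^ Suc j<..<a - 1 / b ^ j + (real d + 1) / b ^ Suc j} \<subseteq> C_set b d"
    proof (rule C_set_digit_interval[OF b])
      fix s :: real assume s: "0 \<le> s" "s < (real d + 1) / b"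
      moreover have "(real d + 1) / b \<le> 1"
        using d_le b by simp
      ultimately have s1: "s < 1" by linarith
      \<comment> \<open>\<open>a + \<delta>\<close> is the point at relative position
        \<open>s\<close> in the interval of length \<open>1 / b ^ j\<close> that ends at
        \<open>a\<close>.\<close>
      define \<delta> where "\<delta> = - ((1 - s) / b ^ j)"
      have *: "(beta_map b ^^ i) a + b ^ i * \<delta> \<in> {0..<1}" if i: "i \<le> k" for i
      proof -
        have eq: "b ^ i * \<delta> = - ((1 - s) / b ^ (j - i))"
          using b i k by (simp add: power_diff \<delta>_def)
        \<comment> \<open>Since digit \<open>j\<close> of \<open>a\<close> is at least 1, the
          \<open>i\<close>-th iterate leaves room \<open>1 / b ^ (j - i)\<close> to its
          left.\<close>
        have "1 \<le> b * (beta_map b ^^ k) a"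
          using m m1 by simp
        also have "(beta_map b ^^ k) a = (beta_map b ^^ (k - i)) ((beta_map b ^^ i) a)"
          using i funpow_add[of "k - i" i "beta_map b"] by simp
        also have "b * \<dots> \<le> b * (b ^ (k - i) * (beta_map b ^^ i) a)"
          using b rng[of i] by (intro mult_left_mono beta_map_funpow_le) auto
        also have "\<dots> = b ^ (j - i) * (beta_map b ^^ i) a"
          using k i by (simp add: Suc_diff_le)
        finally have "1 / b ^ (j - i) \<le> (beta_map b ^^ i) a"
          using b by (simp add: field_simps)
        moreover have "(1 - s) / b ^ (j - i) \<le> 1 / b ^ (j - i)" "0 \<le> (1 - s) / b ^ (j - i)"
          using s s1 b by (auto simp: divide_right_mono)
        ultimately show ?thesis
          using rng[of i] unfolding eq by auto
      qed
      have eq: "a - 1 / b ^ j + s / b ^ j = a + \<delta>"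
        by (simp add: \<delta>_def diff_divide_distrib)
      have "b * (beta_map b ^^ k) (a + \<delta>) = of_int (m - 1) + s"
      proof -
        have "b * (b ^ k * \<delta>) = s - 1"
          using b by (simp add: k \<delta>_def)
        then show ?thesis
          using beta_map_funpow_translate[OF *, of k] m by (simp add: distrib_left)
      qed
      then have "(beta_map b ^^ j) (a + \<delta>) = frac (of_int (m - 1) + s)"
        unfolding k beta_map_funpow_Suc by simp
      also have "\<dots> = s"
        using s s1 by (simp add: frac_unique_iff)
      finally show "a - 1 / b ^ j + s / b ^ j \<in> {0..<1} \<and>
          (beta_map b ^^ j) (a - 1 / b ^ j + s / b ^ j) = s"
        using *[of 0] unfolding eq by auto
    qed
    moreover have "x - 2 / b ^ j \<le> a - 1 / b ^ j" "a - 1 / b ^ j \<le> x"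
      using tj b by (auto simp: a_def)
    ultimately show ?thesis by blast
  qed
qed

text \<open>Relative density at every scale, the input to the game; \<open>c\<close> is the midpoint
  of the interval found. For positive \<open>d\<close>, the interval ends at most
  \<open>1 / b ^ j\<close> to the right of \<open>x\<close> because \<open>d + 1\<close> is at most
  \<open>b\<close>.\<close>

lemma C_set_syndetic:
  assumes b: "b > 1" and d: "d \<le> min_limit_digit b" and x: "x \<in> {0..<1}"
  shows "\<exists>c. {c - 1 / (2 * b ^ Suc j)<..<c + 1 / (2 * b ^ Suc j)} \<subseteq> C_set b d \<and> \<bar>x - c\<bar> \<le> 2 / b ^ j"
proof -
  obtain a where a: "{a + real d / b ^ Suc j<..<a + (real d + 1) / b ^ Suc j} \<subseteq> C_set b d"
    "x - 2 / b ^ j \<le> a" "a + (real d + 1) / b ^ Suc j \<le> x + 2 / b ^ j"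
  proof (cases "d = 0")
    case True
    with C_set_zero_interval[OF b x, of j] that show ?thesis by auto
  next
    case False
    have "(real d + 1) / b ^ Suc j \<le> b / b ^ Suc j"
      using le_min_limit_digit_imp_le[OF b d] b by (intro divide_right_mono) auto
    also have "\<dots> \<le> 2 / b ^ j"
      using b by (simp add: divide_simps)
    finally show ?thesis
      using C_set_pos_interval[OF b d False x, of j] that by force
  qed
  define c where "c = a + (2 * real d + 1) / (2 * b ^ Suc j)"
  have lo: "c - 1 / (2 * b ^ Suc j) = a + real d / b ^ Suc j"
    and hi: "c + 1 / (2 * b ^ Suc j) = a + (real d + 1) / b ^ Suc j"
    using b by (simp_all add: c_def field_simps)
  have "0 \<le> real d / b ^ Suc j" "0 \<le> 1 / (2 * b ^ Suc j)"
    using b by auto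
  then have "\<bar>x - c\<bar> \<le> 2 / b ^ j"
    using a lo hi by linarith
  then show ?thesis
    using a(1) lo hi by (intro exI[of _ c]) (simp del: power_Suc)
qed

section \<open>The game on an interval\<close>

text \<open>The argument \<open>xs\<close> lists Bob's centers so far, \<open>c\<close> maps Bob's center at stage \<open>N\<close> to Alice's
  goal, and \<open>r n\<close> is the largest legal displacement.\<close>

definition pursue :: "(nat \<Rightarrow> real) \<Rightarrow> nat \<Rightarrow> (real \<Rightarrow> real) \<Rightarrow> real list \<Rightarrow> real" where
  "pursue r N c xs =
     (let n = length xs - 1; x = last xs in
      if n < N then x else x + max (- r n) (min (r n) (c (xs ! N) - x)))"

text \<open>In the whole line the balls are nested and closed, so Bob's centers converge. Since
  \<open>X\<close> need not be closed, membership of the limit in \<open>X\<close> remains a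
  condition.\<close>

lemma schmidt_nested_singleton:
  fixes x y :: "nat \<Rightarrow> real"
  assumes \<alpha>: "0 < \<alpha>" "\<alpha> < 1" and \<beta>: "0 < \<beta>" "\<beta> < 1" and \<rho>: "\<rho> > 0"
    and A: "\<And>n. n \<ge> 1 \<Longrightarrow> alice_legal X \<alpha> \<beta> \<rho> x y n" and B: "\<And>n. bob_legal X \<alpha> \<beta> \<rho> x y n"
  obtains \<omega> where "x \<longlonglongrightarrow> \<omega>"
    and "\<omega> \<in> X \<Longrightarrow> (\<Inter>n\<in>{1..}. alice_ball X \<alpha> \<beta> \<rho> y n) \<inter> (\<Inter>n. bob_ball X \<alpha> \<beta> \<rho> x n) = {\<omega>}"
proof -
  define R where "R = game_radius \<alpha> \<beta> \<rho>"
  define S where "S n = cball (x n) (R n)" for n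
  have ab: "0 < \<alpha> * \<beta>" "\<alpha> * \<beta> < 1"
    using \<alpha> \<beta> mult_strict_mono[of \<alpha> 1 \<beta> 1] by auto
  have R_pos: "R n > 0" for n
    using ab \<rho> by (simp add: R_def game_radius_def)
  have R_lim: "R \<longlonglongrightarrow> 0"
    unfolding R_def game_radius_def using ab
    by (intro tendsto_mult_left_zero LIMSEQ_realpow_zero) auto
  have SA: "S (Suc n) \<subseteq> cball (y (Suc n)) (\<alpha> * R n)" for n
    using B[of "Suc n"] by (auto simp: S_def R_def bob_legal_def cball_subset_cball_iff dist_commute
        intro!: subset_cball order_trans[OF dist_triangle])
  have AS: "cball (y (Suc n)) (\<alpha> * R n) \<subseteq> S n" for n
    using A[of "Suc n"]
    by (auto simp: S_def R_def alice_legal_def cball_subset_cball_iff dist_commute)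
  have mono: "S n \<subseteq> S m" if "m \<le> n" for m n
    using that by (rule lift_Suc_antimono_le[rotated]) (use SA AS in blast)
  have sing: "\<exists>a. \<Inter>(range S) = {a}"
  proof (rule decreasing_closed_nest_sing)
    fix \<epsilon> :: real assume "\<epsilon> > 0"
    then have "eventually (\<lambda>n. R n < \<epsilon> / 2) sequentially"
      using R_lim by (intro order_tendstoD) auto
    then obtain n where n: "R n < \<epsilon> / 2"
      by (auto simp: eventually_sequentially)
    have "dist u v < \<epsilon>" if "u \<in> S n" "v \<in> S n" for u v
      using that n dist_triangle2[of u v "x n"] by (auto simp: S_def dist_commute)
    then show "\<exists>n. \<forall>u\<in>S n. \<forall>v\<in>S n. dist u v < \<epsilon>"
      by blast
  qed (use mono R_pos in \<open>auto simp: S_def not_less less_imp_le\<close>)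
  then obtain \<omega> where \<omega>: "\<Inter>(range S) = {\<omega>}"
    by blast
  then have \<omega>_in: "\<omega> \<in> S n" for n
    by blast
  have "x \<longlonglongrightarrow> \<omega>"
  proof (rule LIM_zero_cancel, rule Lim_null_comparison[OF _ R_lim])
    show "eventually (\<lambda>n. norm (x n - \<omega>) \<le> R n) sequentially"
      using \<omega>_in by (auto simp: S_def dist_norm)
  qed
  moreover have "(\<Inter>n\<in>{1..}. alice_ball X \<alpha> \<beta> \<rho> y n) \<inter> (\<Inter>n. bob_ball X \<alpha> \<beta> \<rho> x n) = {\<omega>}"
    if "\<omega> \<in> X"
  proof -
    have "(\<Inter>n. bob_ball X \<alpha> \<beta> \<rho> x n) = {\<omega>}"
      using \<omega> that by (auto simp: bob_ball_def S_def R_def)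
    moreover have "\<omega> \<in> alice_ball X \<alpha> \<beta> \<rho> y n" if "n \<ge> 1" for n
      using \<omega>_in[of n] SA[of "n - 1"] that \<open>\<omega> \<in> X\<close> by (auto simp: alice_ball_def R_def)
    ultimately show ?thesis by auto
  qed
  ultimately show ?thesis
    using that by blast
qed

text \<open>The goal is chosen once, at stage \<open>N\<close>. \<open>reach\<close> controls the
  final distance if Alice never catches it, \<open>stay\<close> the final distance after she
  has.\<close>

lemma schmidt_winning_radius_pursue:
  fixes X S :: "real set"
  assumes \<alpha>: "0 < \<alpha>" "\<alpha> < 1" and \<beta>: "0 < \<beta>" "\<beta> < 1" and \<rho>: "\<rho> > 0"
    and X: "convex X" and S: "S \<subseteq> X" and h: "h > 0"
    and synd: "\<And>x. x \<in> X \<Longrightarrow> \<exists>c. {c - h<..<c + h} \<subseteq> S \<and> \<bar>x - c\<bar> \<le> D"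
    and reach: "D - (1 - 2 * \<alpha> + \<alpha> * \<beta>) / (1 - \<alpha> * \<beta>) * game_radius \<alpha> \<beta> \<rho> N < h"
    and stay: "\<alpha> * (1 - 2 * \<beta> + \<alpha> * \<beta>) / (1 - \<alpha> * \<beta>) * game_radius \<alpha> \<beta> \<rho> N < h"
  shows "schmidt_winning_radius X \<alpha> \<beta> \<rho> S"
proof -
  define R where "R = game_radius \<alpha> \<beta> \<rho>"
  define p q where "p = (1 - 2 * \<alpha> + \<alpha> * \<beta>) / (1 - \<alpha> * \<beta>)"
    and "q = \<alpha> * (1 - 2 * \<beta> + \<alpha> * \<beta>) / (1 - \<alpha> * \<beta>)"
  have ab: "0 < \<alpha> * \<beta>" "\<alpha> * \<beta> < 1"
    using \<alpha> \<beta> mult_strict_mono[of \<alpha> 1 \<beta> 1] by auto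
  have R_pos: "R n > 0" for n
    using ab \<rho> by (simp add: R_def game_radius_def)
  have R_Suc: "R (Suc n) = \<alpha> * \<beta> * R n" for n
    by (simp add: R_def game_radius_def)
  have R_lim: "R \<longlonglongrightarrow> 0"
    unfolding R_def game_radius_def using ab
    by (intro tendsto_mult_left_zero LIMSEQ_realpow_zero) auto
  \<comment> \<open>\<open>p * R n\<close> is Alice's total net gain from stage \<open>n\<close> on,
    as a geometric series. \<open>q * R n\<close> is what remains of Bob's escape
    \<open>\<alpha> * (1 - \<beta>) * R n\<close> from the goal after her later gains.\<close>
  have p_eq: "p = 1 - 2 * \<alpha> + \<alpha> * \<beta> + p * (\<alpha> * \<beta>)" and q_eq: "q + p * (\<alpha> * \<beta>) = \<alpha> * (1 - \<beta>)"
  proof -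
    have "p * (1 - \<alpha> * \<beta>) = 1 - 2 * \<alpha> + \<alpha> * \<beta>" "q * (1 - \<alpha> * \<beta>) = \<alpha> * (1 - 2 * \<beta> + \<alpha> * \<beta>)"
      using ab by (simp_all add: p_def q_def)
    then show "p = 1 - 2 * \<alpha> + \<alpha> * \<beta> + p * (\<alpha> * \<beta>)"
      by (simp add: algebra_simps)
    have "(q + p * (\<alpha> * \<beta>)) * (1 - \<alpha> * \<beta>) = q * (1 - \<alpha> * \<beta>) + p * (1 - \<alpha> * \<beta>) * (\<alpha> * \<beta>)"
      by (simp add: algebra_simps)
    also have "\<dots> = \<alpha> * (1 - \<beta>) * (1 - \<alpha> * \<beta>)"
      unfolding \<open>p * (1 - \<alpha> * \<beta>) = _\<close> \<open>q * (1 - \<alpha> * \<beta>) = _\<close> by (simp add: algebra_simps)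
    finally show "q + p * (\<alpha> * \<beta>) = \<alpha> * (1 - \<beta>)"
      using ab by simp
  qed
  obtain c where c: "\<And>x. x \<in> X \<Longrightarrow> {c x - h<..<c x + h} \<subseteq> S" "\<And>x. x \<in> X \<Longrightarrow> \<bar>x - c x\<bar> \<le> D"
    using synd by metis
  have cX: "c x \<in> X" if "x \<in> X" for x
  proof -
    have "c x \<in> {c x - h<..<c x + h}"
      using h by simp
    then show ?thesis
      using c(1)[OF that] S by blast
  qed
  define \<sigma> where "\<sigma> = pursue (\<lambda>n. (1 - \<alpha>) * R n) N c"
  show ?thesis
    unfolding schmidt_winning_radius_def Let_def
  proof (intro exI[of _ \<sigma>] allI conjI impI)
    fix x :: "nat \<Rightarrow> real"
    define y where "y n = \<sigma> (map x [0..<n])" for n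
    have y_Suc: "y (Suc n) = (if n < N then x n else
        x n + max (- ((1 - \<alpha>) * R n)) (min ((1 - \<alpha>) * R n) (c (x N) - x n)))" for n
      by (auto simp: y_def \<sigma>_def pursue_def Let_def nth_append)
    have legal: "alice_legal X \<alpha> \<beta> \<rho> x y n"
      if n: "n \<ge> 1" and bob: "\<forall>m<n. bob_legal X \<alpha> \<beta> \<rho> x y m" for n
    proof -
      obtain k where k: "n = Suc k"
        using n by (cases n) auto
      have xX: "x m \<in> X" if "m \<le> k" for m
        using bob that by (auto simp: k bob_legal_def)
      have r: "0 < (1 - \<alpha>) * R k"
        using \<alpha> R_pos by simp
      have "dist (x k) (y n) \<le> (1 - \<alpha>) * R k"
        using r by (auto simp: k y_Suc dist_real_def)
      moreover have "y n \<in> X"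
      proof (cases "k < N")
        case True
        then show ?thesis using xX by (simp add: k y_Suc)
      next
        case False
        \<comment> \<open>The clipped displacement never overshoots the goal, so convexity keeps
          Alice in \<open>X\<close>.\<close>
        then have "y n \<in> closed_segment (x k) (c (x N))"
          using r by (auto simp: k y_Suc closed_segment_eq_real_ivl)
        also have "\<dots> \<subseteq> X"
          using X xX[of k] cX[OF xX[of N]] False by (intro closed_segment_subset) auto
        finally show ?thesis .
      qed
      ultimately show ?thesis
        by (simp add: alice_legal_def k R_def algebra_simps)
    qed
    then show "alice_legal X \<alpha> \<beta> \<rho> x (\<lambda>n. \<sigma> (map x [0..<n])) n"
      if "n \<ge> 1" "\<forall>m<n. bob_legal X \<alpha> \<beta> \<rho> x (\<lambda>n. \<sigma> (map x [0..<n])) m" for n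
      using that unfolding y_def by blast
    assume "\<forall>n. bob_legal X \<alpha> \<beta> \<rho> x (\<lambda>n. \<sigma> (map x [0..<n])) n"
    then have bob: "bob_legal X \<alpha> \<beta> \<rho> x y n" for n
      by (simp add: y_def[abs_def])
    have alice: "alice_legal X \<alpha> \<beta> \<rho> x y n" if "n \<ge> 1" for n
      using legal bob that by blast
    obtain \<omega> where \<omega>: "x \<longlonglongrightarrow> \<omega>"
      "\<omega> \<in> X \<Longrightarrow> (\<Inter>n\<in>{1..}. alice_ball X \<alpha> \<beta> \<rho> y n) \<inter> (\<Inter>n. bob_ball X \<alpha> \<beta> \<rho> x n) = {\<omega>}"
      using schmidt_nested_singleton[OF \<alpha> \<beta> \<rho> alice bob] by blast
    have xN: "x N \<in> X"
      using bob by (simp add: bob_legal_def)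
    define e where "e = c (x N)"
    \<comment> \<open>Worst final distance to \<open>e\<close>: Bob retreats forever, or Alice has reached \<open>e\<close> and Bob leaves it.\<close>
    define \<Phi> where "\<Phi> = max 0 (max (D - p * R N) (q * R N))"
    have \<Phi>: "\<Phi> < h" "0 \<le> \<Phi>"
      using reach stay h by (auto simp: \<Phi>_def p_def q_def R_def)
    have R_antimono: "R n \<le> R N" if "n \<ge> N" for n
      using that
    proof (rule lift_Suc_antimono_le[rotated])
      show "R (Suc n) \<le> R n" for n
        using ab R_pos[of n] unfolding R_Suc by (intro mult_left_le_one_le) auto
    qed
    \<comment> \<open>The distance minus the gain still to come stays below \<open>\<Phi>\<close>,
      so \<open>\<Phi>\<close> bounds the distance in the limit.\<close>
    have inv: "\<bar>x n - e\<bar> \<le> \<Phi> + p * R n" if "n \<ge> N" for n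
      using that
    proof (induction n rule: dec_induct)
      case base
      then show ?case
        using c(2)[OF xN] by (simp add: e_def \<Phi>_def)
    next
      case (step n)
      have r: "0 < (1 - \<alpha>) * R n"
        using \<alpha> R_pos by simp
      have qR: "q * R n \<le> \<Phi>"
      \<comment> \<open>For negative \<open>q\<close> the values \<open>q * R n\<close> increase
        with \<open>n\<close>, and the 0 in \<open>\<Phi>\<close> takes over as the bound.\<close>
      proof (cases "q \<ge> 0")
        case True
        then have "q * R n \<le> q * R N"
          using R_antimono[of n] step by (intro mult_left_mono) auto
        then show ?thesis by (simp add: \<Phi>_def)
      next
        case False
        then have "q * R n \<le> 0"
          using R_pos[of n] by (simp add: mult_nonpos_nonneg)
        with \<Phi> show ?thesis by simp
      qed
      have "\<bar>y (Suc n) - e\<bar> \<le> max 0 (\<bar>x n - e\<bar> - (1 - \<alpha>) * R n)"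
        using step r by (auto simp: y_Suc e_def)
      moreover have "\<bar>x (Suc n) - y (Suc n)\<bar> \<le> \<alpha> * (1 - \<beta>) * R n"
        using bob[of "Suc n"] R_Suc[of n]
        by (simp add: bob_legal_def dist_real_def R_def[symmetric] abs_minus_commute algebra_simps)
      ultimately have "\<bar>x (Suc n) - e\<bar> \<le>
          max 0 (\<Phi> + p * R n - (1 - \<alpha>) * R n) + \<alpha> * (1 - \<beta>) * R n"
        using step.IH by linarith
      moreover have "\<alpha> * (1 - \<beta>) * R n = q * R n + p * R (Suc n)"
        unfolding q_eq[symmetric] R_Suc by (simp add: algebra_simps)
      moreover have "p * R n = (1 - 2 * \<alpha> + \<alpha> * \<beta>) * R n + p * R (Suc n)"
        by (subst p_eq) (simp add: R_Suc algebra_simps)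
      then have "p * R n - (1 - \<alpha>) * R n + \<alpha> * (1 - \<beta>) * R n = p * R (Suc n)"
        by (simp add: algebra_simps)
      ultimately show ?case
        using qR by linarith
    qed
    have "\<bar>\<omega> - e\<bar> \<le> \<Phi> + p * 0"
    proof (rule LIMSEQ_le)
      show "(\<lambda>n. \<bar>x n - e\<bar>) \<longlonglongrightarrow> \<bar>\<omega> - e\<bar>"
        by (intro tendsto_intros \<omega>)
      show "(\<lambda>n. \<Phi> + p * R n) \<longlonglongrightarrow> \<Phi> + p * 0"
        by (intro tendsto_intros R_lim)
    qed (use inv in blast)
    then have "\<omega> \<in> {e - h<..<e + h}"
      using \<Phi> by auto
    \<comment> \<open>This also gives the membership in \<open>X\<close> that
      \<open>schmidt_nested_singleton\<close> left open.\<close>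
    then have "\<omega> \<in> S"
      using c(1)[OF xN] by (auto simp: e_def)
    with \<omega>(2) S show "\<exists>\<omega>\<in>S. (\<Inter>n\<in>{1..}. alice_ball X \<alpha> \<beta> \<rho> (\<lambda>n. \<sigma> (map x [0..<n])) n) \<inter>
        (\<Inter>n. bob_ball X \<alpha> \<beta> \<rho> x n) = {\<omega>}"
      unfolding y_def[abs_def] by blast
  qed
qed

section \<open>Matching the scales\<close>

text \<open>On a logarithmic scale, integer translates of multiples of the irrational
  \<open>log b \<kappa>\<close> have to hit an open interval; fractional parts of such multiples are
  dense.\<close>

lemma power_scale_dense:
  fixes b \<kappa> r p q :: real
  assumes b: "b > 1" and \<kappa>: "0 < \<kappa>" "\<kappa> < 1" and irr: "log b \<kappa> \<notin> \<rat>"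
    and r: "r > 0" and p: "0 < p" "p < q"
  shows "\<exists>n j. p < \<kappa> ^ n * r * b ^ j \<and> \<kappa> ^ n * r * b ^ j < q"
proof -
  define \<theta> where "\<theta> = log b \<kappa>"
  have \<theta>: "\<theta> < 0"
    using b \<kappa> by (simp add: \<theta>_def)
  have pq: "log b p < log b q"
    using b p by simp
  \<comment> \<open>\<open>N\<close> powers of \<open>\<kappa>\<close> bring \<open>r\<close> down
    to at most \<open>p\<close>. This makes the exponent of \<open>b\<close> found below positive,
    hence a natural number.\<close>
  obtain N :: nat where N: "(log b r - log b p) / (- \<theta>) \<le> real N"
    using real_arch_simple by blast
  define m where "m = (log b p + log b q) / 2 - log b r - real N * \<theta>"
  obtain k l :: int where kl: "k > 0" "\<bar>of_int k * \<theta> - of_int l - m\<bar> < (log b q - log b p) / 2"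
    using irr pq sequence_of_fractional_parts_is_dense[of \<theta> "(log b q - log b p) / 2" m]
    unfolding \<theta>_def[symmetric] by (metis diff_gt_0_iff_gt half_gt_zero)
  define n where "n = nat k + N"
  have n: "real n = of_int k + real N"
    using kl(1) by (simp add: n_def)
  have "\<bar>real n * \<theta> + log b r - of_int l - (log b p + log b q) / 2\<bar> < (log b q - log b p) / 2"
    using kl(2) by (simp add: n m_def algebra_simps)
  then have bounds: "log b p < real n * \<theta> + log b r - of_int l"
    "real n * \<theta> + log b r - of_int l < log b q"
    unfolding abs_less_iff by argo+
  have "log b r - log b p \<le> real N * (- \<theta>)"
    using N pos_divide_le_eq[of "- \<theta>" "log b r - log b p" "real N"] \<theta> by linarith
  also have "\<dots> \<le> real n * (- \<theta>)"
    using \<theta> kl(1) by (intro mult_right_mono) (auto simp: n)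
  finally have "of_int l < (0 :: real)"
    using bounds(1) by linarith
  then obtain j :: nat where j: "l = - int j"
    by (metis neg_int_cases of_int_less_0_iff)
  define w where "w = \<kappa> ^ n * r * b ^ j"
  have w: "w > 0" "log b w = real n * \<theta> + log b r + real j"
    using b \<kappa> r by (simp_all add: w_def log_mult log_nat_power \<theta>_def)
  have "p < w" "w < q"
    using bounds w(2) log_less_cancel_iff[OF b p(1) w(1)] log_less_cancel_iff[OF b w(1), of q] p
    by (simp_all add: j)
  then show ?thesis
    by (auto simp: w_def)
qed

text \<open>Multiplying by \<open>b\<close> cannot jump over a window of ratio \<open>b\<close>:
  starting at or below \<open>p\<close>, the first value above \<open>p\<close> is at most
  \<open>b * p\<close>.\<close>

lemma power_scale_interval:
  fixes b \<kappa> r p :: real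
  assumes b: "b > 1" and \<kappa>: "0 < \<kappa>" "\<kappa> < 1" and r: "r > 0" and p: "0 < p"
  shows "\<exists>n j. p < \<kappa> ^ n * r * b ^ j \<and> \<kappa> ^ n * r * b ^ j \<le> b * p"
proof -
  obtain n where n: "\<kappa> ^ n < p / r"
    using real_arch_pow_inv[of "p / r" \<kappa>] \<kappa> r p by auto
  define w where "w = \<kappa> ^ n * r"
  have w: "0 < w" "w \<le> p"
    using n \<kappa> r by (simp_all add: w_def field_simps)
  define j where "j = (LEAST j. p < w * b ^ j)"
  obtain j0 where "p / w < b ^ j0"
    using real_arch_pow[OF b] by blast
  then have "p < w * b ^ j0"
    using w by (simp add: field_simps)
  then have j: "p < w * b ^ j"
    unfolding j_def by (rule LeastI)
  then have "j \<noteq> 0"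
    using w by (intro notI) simp
  then obtain i where i: "j = Suc i"
    using not0_implies_Suc by blast
  then have "w * b ^ i \<le> p"
    using not_less_Least[of i "\<lambda>j. p < w * b ^ j"] by (simp add: j_def not_less)
  then have "w * b ^ j \<le> b * p"
    using b by (simp add: i mult.left_commute)
  with j show ?thesis
    by (auto simp: w_def)
qed

text \<open>The common factor \<open>w\<close> in \<open>lo\<close> and \<open>hi\<close> is Bob's
  radius at stage \<open>n\<close> in units of the half-length \<open>h\<close> of the target
  interval. In these units the distance \<open>2 / b ^ j\<close> is \<open>4 * b\<close>, which is
  at most \<open>2 * M\<close>.\<close>

lemma C_set_winning_radius:
  assumes b: "b > 1" and d: "d \<le> min_limit_digit b" and M: "2 * b \<le> M"
    and \<alpha>: "0 < \<alpha>" "\<alpha> < 1" and \<beta>: "0 < \<beta>" "\<beta> < 1" and \<rho>: "\<rho> > 0"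
    and lo: "2 * M - 1 < (1 - 2 * \<alpha> + \<alpha> * \<beta>) / (1 - \<alpha> * \<beta>) * ((\<alpha> * \<beta>) ^ n * (2 * b * \<rho>) * b ^ j)"
    and hi: "\<alpha> * (1 - 2 * \<beta> + \<alpha> * \<beta>) / (1 - \<alpha> * \<beta>) * ((\<alpha> * \<beta>) ^ n * (2 * b * \<rho>) * b ^ j) < 1"
  shows "schmidt_winning_radius {0..<1} \<alpha> \<beta> \<rho> (C_set b d)"
proof -
  define h where "h = 1 / (2 * b ^ Suc j)"
  define w where "w = (\<alpha> * \<beta>) ^ n * (2 * b * \<rho>) * b ^ j"
  have h: "h > 0"
    using b by (simp add: h_def)
  have rad: "game_radius \<alpha> \<beta> \<rho> n = w * h"
    using b by (simp add: game_radius_def h_def w_def)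
  have "2 / b ^ j = 4 * b * h"
    using b by (simp add: h_def)
  also have "\<dots> \<le> 2 * M * h"
    using M h by (intro mult_right_mono) auto
  finally have Mh: "2 / b ^ j \<le> 2 * M * h" .
  show ?thesis
  proof (rule schmidt_winning_radius_pursue[OF \<alpha> \<beta> \<rho> _ _ h])
    show "C_set b d \<subseteq> {0..<1}"
      by (auto simp: C_set_def)
    show "\<exists>c. {c - h<..<c + h} \<subseteq> C_set b d \<and> \<bar>x - c\<bar> \<le> 2 * M * h" if "x \<in> {0..<1}" for x
      using C_set_syndetic[OF b d that, of j] Mh unfolding h_def by (meson order_trans)
    show "2 * M * h - (1 - 2 * \<alpha> + \<alpha> * \<beta>) / (1 - \<alpha> * \<beta>) * game_radius \<alpha> \<beta> \<rho> n < h"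
      using mult_strict_right_mono[OF lo h] unfolding rad w_def by (simp add: algebra_simps)
    show "\<alpha> * (1 - 2 * \<beta> + \<alpha> * \<beta>) / (1 - \<alpha> * \<beta>) * game_radius \<alpha> \<beta> \<rho> n < h"
      using mult_strict_right_mono[OF hi h] unfolding rad w_def by (simp add: algebra_simps)
  qed simp
qed

theorem theorem2p6:
  fixes b :: real and d :: nat
  assumes "b > 1"
    and "K_const b < \<infinity>"
    and "d \<in> digits b"
    and "d \<le> min_limit_digit b"
  shows "(\<forall>\<alpha>\<in>{0<..<1}. \<forall>\<beta>\<in>{0<..<1}. log b (\<alpha> * \<beta>) \<notin> \<rat> \<longrightarrow> \<beta> > A_bound b \<alpha> \<longrightarrow>
             schmidt_winning2 {0..<1} \<alpha> \<beta> (C_set b d)) \<and>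
         (\<forall>\<alpha>\<in>{0<..<1}. \<alpha> < 1 / (2 * real (the_enat (K_const b)) * b\<^sup>2 + 4 * b\<^sup>2 + 1) \<longrightarrow>
             schmidt_winning {0..<1} \<alpha> (C_set b d))"
proof -
  note b = assms(1) and d = assms(4)
  define M where "M = real (the_enat (K_const b)) * b + 2 * b"
  have M: "2 * b \<le> M" "2 < M"
    using b by (simp_all add: M_def add_strict_increasing2)
  have ab: "0 < \<alpha> * \<beta>" "\<alpha> * \<beta> < 1" if "\<alpha> \<in> {0<..<1}" "\<beta> \<in> {0<..<1}" for \<alpha> \<beta> :: real
    using that mult_strict_mono[of \<alpha> 1 \<beta> 1] by auto
  show ?thesis
  proof (intro conjI ballI impI)
    fix \<alpha> \<beta> :: real
    assume \<alpha>: "\<alpha> \<in> {0<..<1}" and \<beta>: "\<beta> \<in> {0<..<1}"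
      and irr: "log b (\<alpha> * \<beta>) \<notin> \<rat>" and A: "\<beta> > A_bound b \<alpha>"
    note ab = ab[OF \<alpha> \<beta>]
    define u v where "u = 1 - 2 * \<alpha> + \<alpha> * \<beta>" and "v = \<alpha> * (1 - 2 * \<beta> + \<alpha> * \<beta>)"
    \<comment> \<open>This makes the denominator of \<open>A_bound\<close> positive; cleared of it,
      the bound on \<open>\<beta>\<close> becomes \<open>(2 * M - 1) * v < u\<close>.\<close>
    have "\<alpha> * (2 * M - 1) < 1 * (4 * M - 1)"
      using \<alpha> M by (intro mult_strict_mono) auto
    then have "0 < \<alpha> * ((4 * M - 1) - \<alpha> * (2 * M - 1))"
      using \<alpha> by simp
    with A have "(2 * M + 1) * \<alpha> - 1 < \<beta> * (\<alpha> * ((4 * M - 1) - \<alpha> * (2 * M - 1)))"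
      by (simp add: A_bound_def Let_def flip: M_def) (simp add: pos_divide_less_eq)
    then have uv: "(2 * M - 1) * v < u"
      by (simp add: u_def v_def algebra_simps)
    have u: "u > 0"
    proof (cases "v \<ge> 0")
      case True
      then have "0 \<le> (2 * M - 1) * v"
        using M by (intro mult_nonneg_nonneg) auto
      with uv show ?thesis by simp
    next
      case False
      \<comment> \<open>At the threshold \<open>\<beta> = 1 / (2 - \<alpha>)\<close> where
        \<open>v\<close> vanishes, \<open>(2 - \<alpha>) * u\<close> equals twice the square of
        \<open>1 - \<alpha>\<close>, and \<open>u\<close> increases with
        \<open>\<beta>\<close>.\<close>
      then have "1 < \<beta> * (2 - \<alpha>)"
        using \<alpha> by (auto simp: v_def zero_le_mult_iff right_diff_distrib mult.commute)
      then have "\<alpha> * 1 < \<alpha> * (\<beta> * (2 - \<alpha>))"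
        using \<alpha> by (intro mult_strict_left_mono) auto
      moreover have "(2 - \<alpha>) * u = 2 * (1 - \<alpha>)\<^sup>2 - \<alpha> + \<alpha> * (\<beta> * (2 - \<alpha>))"
        by (simp add: u_def power2_eq_square algebra_simps)
      ultimately have "0 < (2 - \<alpha>) * u"
        using zero_le_power2[of "1 - \<alpha>"] by linarith
      then show ?thesis
        using \<alpha> by (auto simp: zero_less_mult_iff)
    qed
    show "schmidt_winning2 {0..<1} \<alpha> \<beta> (C_set b d)"
      unfolding schmidt_winning2_def
    proof (intro allI impI)
      fix \<rho> :: real assume \<rho>: "\<rho> > 0"
      define p where "p = (2 * M - 1) * (1 - \<alpha> * \<beta>) / u"
      \<comment> \<open>For \<open>v\<close> not positive the window has no upper end, and any value
        above \<open>p\<close> will do.\<close>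
      define q where "q = (if v > 0 then (1 - \<alpha> * \<beta>) / v else p + 1)"
      have p: "0 < p"
        using M u ab by (simp add: p_def)
      have "p < q"
      proof (cases "v > 0")
        case True
        then have "(2 * M - 1) * (1 - \<alpha> * \<beta>) / u < (1 - \<alpha> * \<beta>) / v \<longleftrightarrow>
            (2 * M - 1) * v * (1 - \<alpha> * \<beta>) < u * (1 - \<alpha> * \<beta>)"
          using u by (simp add: divide_simps mult_ac)
        then show ?thesis
          using True uv ab by (simp add: p_def q_def)
      qed (simp add: q_def)
      then obtain n j where nj: "p < (\<alpha> * \<beta>) ^ n * (2 * b * \<rho>) * b ^ j"
          "(\<alpha> * \<beta>) ^ n * (2 * b * \<rho>) * b ^ j < q"
        using power_scale_dense[OF b ab irr _ p, of "2 * b * \<rho>" q] b \<rho> by auto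
      define w where "w = (\<alpha> * \<beta>) ^ n * (2 * b * \<rho>) * b ^ j"
      have "2 * M - 1 < u / (1 - \<alpha> * \<beta>) * w"
        using nj(1) u ab unfolding w_def[symmetric] p_def by (simp add: field_simps)
      moreover have "v / (1 - \<alpha> * \<beta>) * w < 1"
      proof (cases "v > 0")
        case True
        then show ?thesis
          using nj(2) ab unfolding w_def[symmetric] q_def by (simp add: field_simps)
      next
        case False
        then have "v / (1 - \<alpha> * \<beta>) * w \<le> 0"
          using ab p nj(1) unfolding w_def[symmetric]
          by (intro mult_nonpos_nonneg divide_nonpos_nonneg) auto
        then show ?thesis by simp
      qed
      ultimately show "schmidt_winning_radius {0..<1} \<alpha> \<beta> \<rho> (C_set b d)"
        using \<alpha> \<beta> \<rho> unfolding u_def v_def w_def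
        by (intro C_set_winning_radius[OF b d M(1)]) auto
    qed
  next
    fix \<alpha> :: real
    assume \<alpha>: "\<alpha> \<in> {0<..<1}" and small: "\<alpha> < 1 / (2 * real (the_enat (K_const b)) * b\<^sup>2 + 4 * b\<^sup>2 + 1)"
    have "2 * real (the_enat (K_const b)) * b\<^sup>2 + 4 * b\<^sup>2 + 1 = 2 * M * b + 1"
      by (simp add: M_def power2_eq_square algebra_simps)
    moreover have "0 < 2 * M * b + 1"
      using M b by (simp add: add_pos_pos)
    ultimately have small': "2 * M * b * \<alpha> + \<alpha> < 1"
      using small by (simp add: field_simps)
    show "schmidt_winning {0..<1} \<alpha> (C_set b d)"
      unfolding schmidt_winning_def schmidt_winning2_def
    proof (intro ballI allI impI)
      fix \<beta> \<rho> :: real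
      assume \<beta>: "\<beta> \<in> {0<..<1}" and \<rho>: "\<rho> > 0"
      note ab = ab[OF \<alpha> \<beta>]
      define u v where "u = 1 - 2 * \<alpha> + \<alpha> * \<beta>" and "v = \<alpha> * (1 - 2 * \<beta> + \<alpha> * \<beta>)"
      \<comment> \<open>Replacing \<open>v\<close> by \<open>\<alpha>\<close> makes the estimate
        uniform in \<open>\<beta>\<close>. The resulting \<open>uv\<close> says that, for positive
        \<open>v\<close>, the window spans a factor larger than \<open>b\<close>.\<close>
      have "v \<le> \<alpha> * 1"
        unfolding v_def using \<alpha> \<beta> mult_right_mono[of \<alpha> 2 \<beta>] by (intro mult_left_mono) auto
      then have "(2 * M - 1) * b * v \<le> (2 * M - 1) * b * \<alpha>"
        using M b by (intro mult_left_mono) auto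
      also have "\<dots> = 2 * M * b * \<alpha> - b * \<alpha>"
        by (simp add: algebra_simps)
      also have "\<dots> \<le> 2 * M * b * \<alpha> - \<alpha>"
        using b \<alpha> mult_right_mono[of 1 b \<alpha>] by simp
      also have "\<dots> < u"
        using small' ab by (simp add: u_def)
      finally have uv: "(2 * M - 1) * b * v < u" .
      have "0 < (2 * M) * b * \<alpha>" "\<alpha> \<le> 2 * M * b * \<alpha>"
        using M b \<alpha> mult_mono[of 1 "2 * M" 1 b] by auto
      then have u: "u > 0"
        using small' ab by (simp add: u_def)
      define p where "p = (2 * M - 1) * (1 - \<alpha> * \<beta>) / u"
      have p: "0 < p"
        using M u ab by (simp add: p_def)
      obtain n j where nj: "p < (\<alpha> * \<beta>) ^ n * (2 * b * \<rho>) * b ^ j"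
          "(\<alpha> * \<beta>) ^ n * (2 * b * \<rho>) * b ^ j \<le> b * p"
        using power_scale_interval[OF b ab _ p, of "2 * b * \<rho>"] b \<rho> by auto
      define w where "w = (\<alpha> * \<beta>) ^ n * (2 * b * \<rho>) * b ^ j"
      have "2 * M - 1 < u / (1 - \<alpha> * \<beta>) * w"
        using nj(1) u ab unfolding w_def[symmetric] p_def by (simp add: field_simps)
      moreover have "v / (1 - \<alpha> * \<beta>) * w < 1"
      proof (cases "v > 0")
        case True
        then have "v / (1 - \<alpha> * \<beta>) * w \<le> v / (1 - \<alpha> * \<beta>) * (b * p)"
          using nj(2) ab unfolding w_def[symmetric] by (intro mult_left_mono) auto
        also have "\<dots> = (2 * M - 1) * b * v / u"
          using ab by (simp add: p_def)
        also have "\<dots> < 1"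
          using uv u by simp
        finally show ?thesis .
      next
        case False
        then have "v / (1 - \<alpha> * \<beta>) * w \<le> 0"
          using ab p nj(1) unfolding w_def[symmetric]
          by (intro mult_nonpos_nonneg divide_nonpos_nonneg) auto
        then show ?thesis by simp
      qed
      ultimately show "schmidt_winning_radius {0..<1} \<alpha> \<beta> \<rho> (C_set b d)"
        using \<alpha> \<beta> \<rho> unfolding u_def v_def w_def
        by (intro C_set_winning_radius[OF b d M(1)]) auto
    qed
  qed
qed

end
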